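(* Let $G$ and $H$ be rooted labeled graphs with roots labeled $i$ and $j$ respectively. For a rooted graph $K$ let $K^*$ denote $K$ with one added isolated vertex, rooted at the root of $K$. If $G^*$ is hang-symmetric with root labeled $i$, and $H^*$ is hang-symmetric with root labeled $j$, then $(G*H)^*$ is hang-symmetric with root labeled $(j,i)$, where $G*H$ is the comb product.
   Context: All graphs are finite and simple. A labeled graph $G$ comes with a bijection $\lambda:V(G)\to X$ onto a label set $X$; write $v_x=\lambda^{-1}(x)$ and $L_G=\{ij: v_iv_j\in E(G)\}$ (unordered pairs). For $\sigma\in\operatorname{Sym}(X)$, $G_\sigma$ is the graph on $V(G)$ with edge set $\{v_iv_j:\sigma(i)\sigma(j)\in L_G\}$. $\operatorname{Aut}(G)$ is identified with $\{\sigma\in\operatorname{Sym}(X): G_\sigma=G\}$. An edge-replacement $rs\to kl$ removes an edge $v_rv_s\in E(G)$ and adds $v_kv_l\in E(\overline G)\cup\{v_rv_s\}$; it is feasible if $G-v_rv_s+v_kv_l\cong G$. $R_G$ is the set of feasible edge-replacements $rs\to kl$ with $rs\ne kl$ together with the neutral replacement $\emptyset\to\emptyset$ (nothing changes). $\operatorname{Fer}_G(rs\to kl)=\{\sigma\in\operatorname{Sym}(X): G_\sigma=G-v_rv_s+v_kv_l\}$ and $\operatorname{Fer}_G(\emptyset\to\emptyset)=\operatorname{Aut}(G)$. $\mathcal{E}_G$ is the union of the sets $\operatorname{Fer}_G(e\to e')$ over all $e\to e'\in R_G$. For $i\in X$, $\mathcal{E}_G^i=\{\sigma\in\mathcal{E}_G:\sigma(i)=i\}$;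 the hang group of $G$ at $i$ is $\mathbf{H}_i(G)=\langle\mathcal{E}_G^i\cup\operatorname{Aut}(G)\rangle$, and $G$ is hang-symmetric at $v_i$ (or with root labeled $i$) if $\mathbf{H}_i(G)=\operatorname{Sym}(X)$. Comb product: for a graph $G$ and a graph $H$ with root $v$, $G*H$ has vertex set $V(G)\times V(H)$, with an edge between $(u,v)$ and $(u',v)$ for each $uu'\in E(G)$, and an edge between $(u,w)$ and $(u,w')$ for each $u\in V(G)$ and $ww'\in E(H)$. If $G$, $H$ have label sets $X$, $B$, then $G*H$ has label set $B\times X$, where $(u,w)$ gets the label $(b,x)$ with $b$ the label of $w$ and $x$ the label of $u$. $G*H$ is rooted at the vertex labeled $(j,i)$. *)

theory Defs
  imports "HOL-Algebra.Bij" "HOL-Algebra.Generated_Groups"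
begin

text \<open>The label set \<open>X\<close> of a labeled graph is the image of its vertex set under \<open>label\<close>, so that
  being a bijection onto \<open>X\<close> amounts to injectivity on the vertices. Edges are two-element vertex
  sets.\<close>

record ('v, 'x) lgraph =
  verts :: "'v set"
  edges :: "'v set set"
  label :: "'v \<Rightarrow> 'x"

record ('v, 'x) rlgraph = "('v, 'x) lgraph" +
  root :: 'v

definition vertex_pairs :: "'v set \<Rightarrow> 'v set set" where
  "vertex_pairs V = {e. e \<subseteq> V \<and> card e = 2}"

definition labeled_graph :: "('v, 'x, 'm) lgraph_scheme \<Rightarrow> bool" where
  "labeled_graph G \<longleftrightarrow>
     finite (verts G) \<and> edges G \<subseteq> vertex_pairs (verts G) \<and> inj_on (label G) (verts G)"

definition rooted_labeled_graph :: "('v, 'x, 'm) rlgraph_scheme \<Rightarrow> bool" where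
  "rooted_labeled_graph G \<longleftrightarrow> labeled_graph G \<and> root G \<in> verts G"

definition compl_edges :: "('v, 'x, 'm) lgraph_scheme \<Rightarrow> 'v set set" where
  "compl_edges G = vertex_pairs (verts G) - edges G"

definition graph_isomorphic ::
    "('v, 'x, 'm) lgraph_scheme \<Rightarrow> ('w, 'y, 'n) lgraph_scheme \<Rightarrow> bool" where
  "graph_isomorphic G H \<longleftrightarrow>
     (\<exists>f. bij_betw f (verts G) (verts H) \<and>
          (\<forall>u\<in>verts G. \<forall>w\<in>verts G. {u, w} \<in> edges G \<longleftrightarrow> {f u, f w} \<in> edges H))"

definition labels :: "('v, 'x, 'm) lgraph_scheme \<Rightarrow> 'x set" where
  "labels G = label G ` verts G"

definition vert :: "('v, 'x, 'm) lgraph_scheme \<Rightarrow> 'x \<Rightarrow> 'v" where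
  "vert G = inv_into (verts G) (label G)"

definition label_edges :: "('v, 'x, 'm) lgraph_scheme \<Rightarrow> 'x set set" where
  "label_edges G = {{i, j} | i j. i \<in> labels G \<and> j \<in> labels G \<and> {vert G i, vert G j} \<in> edges G}"

text \<open>\<open>Sym(X)\<close> is \<^term>\<open>BijGroup X\<close>; its elements are \<^term>\<open>undefined\<close> outside \<open>X\<close>.\<close>

definition permuted :: "('v, 'x, 'm) lgraph_scheme \<Rightarrow> ('x \<Rightarrow> 'x) \<Rightarrow> ('v, 'x, 'm) lgraph_scheme" where
  "permuted G \<sigma> =
     G\<lparr>edges := {{vert G i, vert G j} | i j.
                  i \<in> labels G \<and> j \<in> labels G \<and> {\<sigma> i, \<sigma> j} \<in> label_edges G}\<rparr>"

definition Aut :: "('v, 'x, 'm) lgraph_scheme \<Rightarrow> ('x \<Rightarrow> 'x) set" where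
  "Aut G = {\<sigma> \<in> carrier (BijGroup (labels G)). permuted G \<sigma> = G}"

text \<open>In \<^term>\<open>Replace e f\<close> the unordered pairs \<open>e = rs\<close> and \<open>f = kl\<close> are two-element sets of
  labels, not of vertices.\<close>

datatype 'x replacement = Neutral | Replace "'x set" "'x set"

definition replace_edge ::
    "('v, 'x, 'm) lgraph_scheme \<Rightarrow> 'x set \<Rightarrow> 'x set \<Rightarrow> ('v, 'x, 'm) lgraph_scheme" where
  "replace_edge G e f = G\<lparr>edges := (edges G - {vert G ` e}) \<union> {vert G ` f}\<rparr>"

definition edge_replacement :: "('v, 'x, 'm) lgraph_scheme \<Rightarrow> 'x set \<Rightarrow> 'x set \<Rightarrow> bool" where
  "edge_replacement G e f \<longleftrightarrow>
     e \<subseteq> labels G \<and> vert G ` e \<in> edges G \<and>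
     f \<subseteq> labels G \<and> vert G ` f \<in> compl_edges G \<union> {vert G ` e}"

definition feasible :: "('v, 'x, 'm) lgraph_scheme \<Rightarrow> 'x set \<Rightarrow> 'x set \<Rightarrow> bool" where
  "feasible G e f \<longleftrightarrow> edge_replacement G e f \<and> graph_isomorphic (replace_edge G e f) G"

definition feasible_replacements :: "('v, 'x, 'm) lgraph_scheme \<Rightarrow> 'x replacement set" where
  "feasible_replacements G = insert Neutral {Replace e f | e f. feasible G e f \<and> e \<noteq> f}"

fun Fer :: "('v, 'x, 'm) lgraph_scheme \<Rightarrow> 'x replacement \<Rightarrow> ('x \<Rightarrow> 'x) set" where
  "Fer G Neutral = Aut G"
| "Fer G (Replace e f) =
     {\<sigma> \<in> carrier (BijGroup (labels G)). permuted G \<sigma> = replace_edge G e f}"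

definition Fer_perms :: "('v, 'x, 'm) lgraph_scheme \<Rightarrow> ('x \<Rightarrow> 'x) set" where
  "Fer_perms G = (\<Union>r\<in>feasible_replacements G. Fer G r)"

definition Fer_perms_fixing :: "('v, 'x, 'm) lgraph_scheme \<Rightarrow> 'x \<Rightarrow> ('x \<Rightarrow> 'x) set" where
  "Fer_perms_fixing G i = {\<sigma> \<in> Fer_perms G. \<sigma> i = i}"

definition hang_group :: "('v, 'x, 'm) lgraph_scheme \<Rightarrow> 'x \<Rightarrow> ('x \<Rightarrow> 'x) set" where
  "hang_group G i = generate (BijGroup (labels G)) (Fer_perms_fixing G i \<union> Aut G)"

definition hang_symmetric_root :: "('v, 'x, 'm) rlgraph_scheme \<Rightarrow> 'x \<Rightarrow> bool" where
  "hang_symmetric_root G i \<longleftrightarrow>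
     label G (root G) = i \<and> hang_group G i = carrier (BijGroup (labels G))"

text \<open>The vertex and label types are extended by \<^term>\<open>None\<close>, which serves as the new isolated
  vertex and as its (new) label; the old vertices and labels are embedded by \<^term>\<open>Some\<close>.\<close>

definition add_isolated :: "('v, 'x) rlgraph \<Rightarrow> ('v option, 'x option) rlgraph" where
  "add_isolated K =
     \<lparr>verts = insert None (Some ` verts K),
      edges = (\<lambda>e. Some ` e) ` edges K,
      label = map_option (label K),
      root = Some (root K)\<rparr>"

text \<open>The two components of a label are in the opposite order to those of the vertex bearing it.\<close>

definition comb_product :: "('v, 'x) rlgraph \<Rightarrow> ('w, 'b) rlgraph \<Rightarrow> ('v \<times> 'w, 'b \<times> 'x) rlgraph" where
  "comb_product G H =
     \<lparr>verts = verts G \<times> verts H,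
      edges = {{(u, root H), (u', root H)} | u u'. {u, u'} \<in> edges G} \<union>
              {{(u, w), (u, w')} | u w w'. u \<in> verts G \<and> {w, w'} \<in> edges H},
      label = (\<lambda>(u, w). (label H w, label G u)),
      root = (root G, root H)\<rparr>"

lemma rooted_labeled_graph_add_isolated:
  assumes "rooted_labeled_graph K"
  shows "rooted_labeled_graph (add_isolated K)"
  using assms
  by (fastforce simp: rooted_labeled_graph_def labeled_graph_def add_isolated_def vertex_pairs_def
      card_image inj_on_def)

lemma rooted_labeled_graph_comb_product:
  assumes "rooted_labeled_graph G" "rooted_labeled_graph H"
  shows "rooted_labeled_graph (comb_product G H)"
proof -
  have G: "u \<in> verts G \<and> u' \<in> verts G \<and> u \<noteq> u'" if "{u, u'} \<in> edges G" for u u'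
    using assms(1) that
    by (auto simp: rooted_labeled_graph_def labeled_graph_def vertex_pairs_def)
  have H: "u \<in> verts H \<and> u' \<in> verts H \<and> u \<noteq> u'" if "{u, u'} \<in> edges H" for u u'
    using assms(2) that
    by (auto simp: rooted_labeled_graph_def labeled_graph_def vertex_pairs_def)
  have "edges (comb_product G H) \<subseteq> vertex_pairs (verts (comb_product G H))"
    using assms G H
    by (auto simp: rooted_labeled_graph_def comb_product_def vertex_pairs_def card_insert_if)
  then show ?thesis
    using assms
    by (auto simp: rooted_labeled_graph_def labeled_graph_def comb_product_def inj_on_def)
qed

end

theory Submission
  imports Defs "HOL-Combinatorics.Permutations"
begin

text \<open>Write \<open>\<infinity>\<close> for the added isolated vertex and call a vertex \<open>x\<close> of \<open>G\<close> good if the hang group of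
  \<open>(G * H)\<^sup>*\<close> contains every permutation of the copy of \<open>H\<close> at \<open>x\<close> together with \<open>\<infinity>\<close>. If all
  vertices are good, the hang group contains the transposition of \<open>\<infinity>\<close> with any label, hence
  everything.

  A generator for \<open>H\<^sup>*\<close> fixing the root acts on any single copy of \<open>H\<close> as a single edge
  replacement. An automorphism of \<open>H\<^sup>*\<close> may move the root, but if \<open>x\<close> is a leaf of \<open>G\<close> other than
  the root, then acting on the copy at \<open>x\<close> it disturbs only the one edge of \<open>G\<close> at \<open>x\<close>; and if \<open>x\<close> is
  isolated it disturbs nothing. So such vertices are good, and these include all vertices that a
  generator \<open>\<sigma>\<close> for \<open>G\<^sup>*\<close> sends to \<open>\<infinity>\<close>. A generator for \<open>G\<^sup>*\<close> that fixes \<open>\<infinity>\<close> permutes the copies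
  of \<open>H\<close> and transports goodness by conjugation; if \<open>\<sigma>\<close> sends \<open>t\<close> to \<open>\<infinity>\<close> instead, precomposing
  with the transposition of \<open>t\<close> and \<open>\<infinity>\<close> gives a generator that fixes \<open>\<infinity>\<close> and agrees with \<open>\<sigma>\<close> on
  the other vertices of \<open>G\<close>. So the set of good vertices and \<open>\<infinity>\<close> is invariant under all generators
  for \<open>G\<^sup>*\<close>, which generate a transitive group.\<close>

text \<open>HOL-Algebra reserves the bare prefix \<open>inv\<close> for inverses in a group.\<close>

abbreviation inv_fun :: "('a \<Rightarrow> 'b) \<Rightarrow> 'b \<Rightarrow> 'a" where
  "inv_fun \<equiv> Hilbert_Choice.inv"

text \<open>The group generated by \<open>S\<close>, formed with total functions, so that
  composition and inverses need no restriction to a carrier. \<open>hang_group_eq\<close> links it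
  to \<open>generate\<close> in \<open>BijGroup\<close>.\<close>

inductive_set perm_span :: "('a \<Rightarrow> 'a) set \<Rightarrow> ('a \<Rightarrow> 'a) set" for S where
  perm_span_id: "id \<in> perm_span S"
| perm_span_incl: "p \<in> S \<Longrightarrow> p \<in> perm_span S"
| perm_span_inv: "p \<in> S \<Longrightarrow> inv_fun p \<in> perm_span S"
| perm_span_comp: "p \<in> perm_span S \<Longrightarrow> q \<in> perm_span S \<Longrightarrow> p \<circ> q \<in> perm_span S"

text \<open>As \<open>p\<close> preserves the number of edges, mapping all edges but at most one into \<open>L\<close> means that the
  image of \<open>L\<close> arises from \<open>L\<close> by replacing at most one edge.\<close>

definition near_aut :: "'a set set \<Rightarrow> ('a \<Rightarrow> 'a) \<Rightarrow> bool" where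
  "near_aut L p \<longleftrightarrow> (\<exists>f. \<forall>d\<in>L. p ` d \<in> insert f L)"

definition edge_preserving :: "'a set set \<Rightarrow> ('a \<Rightarrow> 'a) \<Rightarrow> bool" where
  "edge_preserving L p \<longleftrightarrow> (\<forall>d\<in>L. p ` d \<in> L)"

text \<open>Only the near-automorphisms must fix \<open>i\<close>; automorphisms may move it. These
  are the inverses of the generators in the hang group, which affects neither the condition at
  \<open>i\<close> nor the generated group.\<close>

definition hang_gens :: "'a set \<Rightarrow> 'a set set \<Rightarrow> 'a \<Rightarrow> ('a \<Rightarrow> 'a) set" where
  "hang_gens X L i = {p. p permutes X \<and> (near_aut L p \<and> p i = i \<or> edge_preserving L p)}"

definition hang_complete :: "'a set \<Rightarrow> 'a set set \<Rightarrow> 'a \<Rightarrow> bool" where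
  "hang_complete X L i \<longleftrightarrow> (\<forall>p. p permutes X \<longrightarrow> p \<in> perm_span (hang_gens X L i))"

definition star_set :: "'a set \<Rightarrow> 'a option set" where
  "star_set X = insert None (Some ` X)"

definition star_edges :: "'a set set \<Rightarrow> 'a option set set" where
  "star_edges L = image Some ` L"

section \<open>Groups generated by permutations\<close>

lemma perm_span_inv_closed:
  assumes "p \<in> perm_span S" and "\<And>q. q \<in> S \<Longrightarrow> bij q"
  shows "bij p \<and> inv_fun p \<in> perm_span S"
  using assms(1)
proof induction
  case (perm_span_inv p)
  then show ?case
    using assms(2) by (auto simp: inv_inv_eq bij_imp_bij_inv intro: perm_span.intros)
next
  \<comment> \<open>Inverting a composition factorwise needs both factors bijective, hence the
    conjunction in the claim.\<close>
  case (perm_span_comp p q)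
  then show ?case
    by (simp add: o_inv_distrib bij_comp perm_span.perm_span_comp del: o_apply)
qed (use assms(2) in \<open>simp_all add: perm_span.intros del: id_apply\<close>)

text \<open>The hypothesis only pulls membership in \<open>A\<close> back along generators.
  Finiteness upgrades this: the inverse of a generator maps \<open>A\<close> injectively into
  itself, hence onto itself.\<close>

lemma perm_span_invariant:
  assumes "finite A" and S: "\<And>q. q \<in> S \<Longrightarrow> bij q" "\<And>q a. q \<in> S \<Longrightarrow> q a \<in> A \<Longrightarrow> a \<in> A"
    and "p \<in> perm_span S"
  shows "p a \<in> A \<longleftrightarrow> a \<in> A"
proof -
  have inv: "inv_fun q a \<in> A \<longleftrightarrow> a \<in> A" if "q \<in> S" for q a
  proof -
    have b: "bij q" using S that by blast
    have "inv_fun q ` A \<subseteq> A"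
      using S(2)[OF that] b by (auto simp: bij_is_surj surj_f_inv_f)
    moreover have "inj (inv_fun q)" using b by (simp add: bij_imp_bij_inv bij_is_inj)
    ultimately have "inv_fun q ` A = A"
      using assms(1) by (meson endo_inj_surj inj_on_subset subset_UNIV)
    then show ?thesis using \<open>inj (inv_fun q)\<close> by (metis inj_image_mem_iff)
  qed
  show ?thesis using assms(4)
  proof (induction arbitrary: a)
    case (perm_span_incl q)
    then show ?case using inv[of q "q a"] S(1)[of q] by (simp add: bij_is_inj)
  qed (use inv in auto)
qed

text \<open>Transpositions generate all permutations of a finite set, and (a b) = (c a)(c b)(c a)
  reduces them to those through the centre \<open>c\<close>.\<close>

lemma star_transpositions_span:
  assumes "finite X" and "c \<in> X" and "\<And>a. a \<in> X \<Longrightarrow> transpose c a \<in> perm_span S"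
    and "p permutes X"
  shows "p \<in> perm_span S"
  using assms(4,1)
proof (induction rule: permutes_induct)
  case id
  then show ?case by (rule perm_span_id)
next
  case (swap a b p)
  have "transpose a b \<in> perm_span S"
  proof (cases "a = c \<or> b = c \<or> a = b")
    case True
    then show ?thesis
      using assms(3) swap by (auto simp: transpose_commute perm_span_id)
  next
    case False
    then have "transpose a b = transpose c a \<circ> (transpose c b \<circ> transpose c a)"
      by (auto simp: fun_eq_iff transpose_def)
    then show ?thesis
      using assms(3) swap by (auto intro: perm_span_comp)
  qed
  then show ?case
    using swap by (intro perm_span_comp)
qed

subsection \<open>Comb products of label graphs\<close>

definition comb_edges :: "'x set \<Rightarrow> 'x set set \<Rightarrow> 'b set set \<Rightarrow> 'b \<Rightarrow> ('b \<times> 'x) set set" where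
  "comb_edges X LG LH j = image (Pair j) ` LG \<union> (\<Union>x\<in>X. image (\<lambda>b. (b, x)) ` LH)"

locale comb_labels =
  fixes X :: "'x set" and LG :: "'x set set" and i :: 'x
    and B :: "'b set" and LH :: "'b set set" and j :: 'b
  assumes finite_X: "finite X" and finite_B: "finite B"
    and LG: "LG \<subseteq> Pow X" and LH: "LH \<subseteq> Pow B"
    and i: "i \<in> X" and j: "j \<in> B"
begin

abbreviation "P \<equiv> star_set (B \<times> X)"
abbreviation "M \<equiv> star_edges (comb_edges X LG LH j)"
abbreviation "gensG \<equiv> hang_gens (star_set X) (star_edges LG) (Some i)"
abbreviation "gensH \<equiv> hang_gens (star_set B) (star_edges LH) (Some j)"
abbreviation "spanP \<equiv> perm_span (hang_gens P M (Some (j, i)))"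

section \<open>Acting on one copy of H and permuting the copies\<close>

definition emb :: "'x \<Rightarrow> 'b option \<Rightarrow> ('b \<times> 'x) option" where
  "emb x = map_option (\<lambda>b. (b, x))"

text \<open>As \<open>emb x\<close> sends \<open>None\<close> to \<open>None\<close>, all copies
  share the one added point. The map \<open>copy x\<close> is a homomorphism, so spans for
  \<open>H\<close> carry over to the product.\<close>

definition copy :: "'x \<Rightarrow> ('b option \<Rightarrow> 'b option) \<Rightarrow> ('b \<times> 'x) option \<Rightarrow> ('b \<times> 'x) option" where
  "copy x \<tau> q = (case q of None \<Rightarrow> emb x (\<tau> None)
     | Some (b, y) \<Rightarrow> if y = x then emb x (\<tau> (Some b)) else q)"

text \<open>The guard \<open>b \<in> B\<close> keeps points outside the label set fixed. A vertex
  sent to \<open>None\<close> would have its whole fibre collapsed, so the lemmas on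
  \<open>outer\<close> require \<open>\<sigma> None = None\<close>.\<close>

definition outer :: "('x option \<Rightarrow> 'x option) \<Rightarrow> ('b \<times> 'x) option \<Rightarrow> ('b \<times> 'x) option" where
  "outer \<sigma> q = (case q of None \<Rightarrow> None
     | Some (b, y) \<Rightarrow> if b \<in> B then map_option (Pair b) (\<sigma> (Some y)) else q)"

lemma M_cases:
  assumes "d \<in> M"
  obtains (base) g where "g \<in> LG" "d = (\<lambda>x. Some (j, x)) ` g"
  | (fibre) x h where "x \<in> X" "h \<in> LH" "d = (\<lambda>b. Some (b, x)) ` h"
  using assms unfolding star_edges_def comb_edges_def by (auto simp: image_image)

lemma base_in_M: "g \<in> LG \<Longrightarrow> (\<lambda>x. Some (j, x)) ` g \<in> M"
  unfolding star_edges_def comb_edges_def by (rule image_eqI[of _ _ "Pair j ` g"]) auto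

lemma fibre_in_M: "x \<in> X \<Longrightarrow> h \<in> LH \<Longrightarrow> (\<lambda>b. Some (b, x)) ` h \<in> M"
  unfolding star_edges_def comb_edges_def
  by (rule image_eqI[of _ _ "(\<lambda>b. (b, x)) ` h"]) auto

lemma copy_emb: "copy x \<tau> (emb x a) = emb x (\<tau> a)"
  by (cases a) (auto simp: copy_def emb_def)

lemma copy_other: "y \<noteq> x \<Longrightarrow> copy x \<tau> (Some (b, y)) = Some (b, y)"
  by (simp add: copy_def)

lemma copy_same: "copy x \<tau> (Some (b, x)) = emb x (\<tau> (Some b))"
  by (simp add: copy_def)

lemma copy_None: "copy x \<tau> None = emb x (\<tau> None)"
  by (simp add: copy_def)

lemma copy_id: "copy x id = id"
  by (auto simp: fun_eq_iff copy_def emb_def split: option.split)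

lemma copy_comp: "copy x (\<tau> \<circ> \<tau>') = copy x \<tau> \<circ> copy x \<tau>'"
proof
  fix q
  show "copy x (\<tau> \<circ> \<tau>') q = (copy x \<tau> \<circ> copy x \<tau>') q"
    by (cases q) (auto simp: copy_None copy_emb copy_def[of x "\<tau> \<circ> \<tau>'"] copy_def[of x \<tau>']
        copy_other)
qed

lemma copy_inv:
  assumes "bij \<tau>"
  shows "bij (copy x \<tau>)" and "inv_fun (copy x \<tau>) = copy x (inv_fun \<tau>)"
proof -
  have 1: "copy x \<tau> \<circ> copy x (inv_fun \<tau>) = id"
    using assms by (simp flip: copy_comp add: copy_id bij_is_surj surj_iff[THEN iffD1])
  have 2: "copy x (inv_fun \<tau>) \<circ> copy x \<tau> = id"
    using assms by (simp flip: copy_comp add: copy_id bij_is_inj inj_iff[THEN iffD1])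
  show "bij (copy x \<tau>)" using 2 1 by (rule o_bij)
  show "inv_fun (copy x \<tau>) = copy x (inv_fun \<tau>)" by (rule inv_unique_comp[OF 1 2])
qed

lemma copy_permutes:
  assumes "\<tau> permutes star_set B" and "x \<in> X"
  shows "copy x \<tau> permutes P"
proof -
  have "copy x \<tau> q = q" if q_notin: "q \<notin> P" for q
  proof -
    obtain b y where q: "q = Some (b, y)" "b \<notin> B \<or> y \<notin> X"
      using q_notin by (cases q) (auto simp: star_set_def)
    show ?thesis
    proof (cases "y = x")
      case True
      then have "\<tau> (Some b) = Some b"
        using q assms by (intro permutes_not_in[OF assms(1)]) (auto simp: star_set_def)
      then show ?thesis using True q by (simp add: copy_same emb_def)
    qed (simp add: q copy_other)
  qed
  moreover have "\<exists>!q. copy x \<tau> q = r" for r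
    using copy_inv(1)[OF permutes_bij[OF assms(1)], of x] by (simp add: bij_iff)
  ultimately show ?thesis by (simp add: permutes_def)
qed

lemma outer_comp:
  assumes "\<sigma>' None = None" and "\<sigma> None = None"
  shows "outer (\<sigma> \<circ> \<sigma>') = outer \<sigma> \<circ> outer \<sigma>'"
  using assms by (auto simp: fun_eq_iff outer_def split: option.split)

lemma outer_id: "outer id = id"
  by (auto simp: fun_eq_iff outer_def split: option.split)

lemma outer_permutes:
  assumes "\<sigma> permutes star_set X" and "\<sigma> None = None"
  shows "outer \<sigma> permutes P"
proof -
  have b: "bij \<sigma>" using assms(1) by (rule permutes_bij)
  then have n: "inv_fun \<sigma> None = None" using assms(2) by (metis bij_inv_eq_iff)
  have "outer \<sigma> \<circ> outer (inv_fun \<sigma>) = id"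
    using b n assms(2)
    by (simp flip: outer_comp add: outer_id bij_is_surj surj_iff[THEN iffD1])
  moreover have "outer (inv_fun \<sigma>) \<circ> outer \<sigma> = id"
    using b n assms(2)
    by (simp flip: outer_comp add: outer_id bij_is_inj inj_iff[THEN iffD1])
  ultimately have "bij (outer \<sigma>)" by (rule o_bij[rotated])
  moreover have "outer \<sigma> q = q" if q_notin: "q \<notin> P" for q
  proof -
    obtain b y where q: "q = Some (b, y)" "b \<notin> B \<or> y \<notin> X"
      using q_notin by (cases q) (auto simp: star_set_def)
    have "\<sigma> (Some y) = Some y" if "y \<notin> X"
      using that by (intro permutes_not_in[OF assms(1)]) (auto simp: star_set_def)
    then show ?thesis using q by (auto simp: outer_def)
  qed
  ultimately show ?thesis by (simp add: permutes_def bij_iff)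
qed


text \<open>The set \<open>A\<close> holds the exceptional images: a singleton when
  \<open>\<tau>\<close> may replace an edge, empty when it is an automorphism.\<close>

lemma copy_fibre:
  assumes "x \<in> X" and "h \<in> LH" and "\<forall>d\<in>star_edges LH. \<tau> ` d \<in> A \<union> star_edges LH"
  shows "copy x \<tau> ` (\<lambda>b. Some (b, x)) ` h \<in> image (emb x) ` A \<union> M"
proof -
  have *: "(\<lambda>b. Some (b, x)) ` g = emb x ` Some ` g" for g
    by (auto simp: emb_def image_image)
  have "\<tau> ` Some ` h \<in> A \<union> star_edges LH"
    using assms by (auto simp: star_edges_def)
  moreover have "copy x \<tau> ` (\<lambda>b. Some (b, x)) ` h = emb x ` \<tau> ` Some ` h"
    by (simp add: * image_image copy_emb)
  moreover have "emb x ` d \<in> M" if d: "d \<in> star_edges LH" for d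
  proof -
    obtain g where "g \<in> LH" "d = Some ` g" using d by (auto simp: star_edges_def)
    then show ?thesis using fibre_in_M[OF assms(1), of g] by (simp add: *)
  qed
  ultimately show ?thesis by auto
qed

lemma copy_other_fibre:
  assumes "x \<noteq> y"
  shows "copy x \<tau> ` (\<lambda>b. Some (b, y)) ` h = (\<lambda>b. Some (b, y)) ` h"
  using assms by (simp add: image_image copy_other)

text \<open>Base edges meet the copy at \<open>x\<close> at most in its root, so it suffices that
  this root stays put.\<close>

lemma copy_base:
  assumes "x \<notin> g \<or> \<tau> (Some j) = Some j"
  shows "copy x \<tau> ` (\<lambda>y. Some (j, y)) ` g = (\<lambda>y. Some (j, y)) ` g"
proof -
  have "copy x \<tau> (Some (j, y)) = Some (j, y)" if "y \<in> g" for y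
    using assms that by (cases "y = x") (auto simp: copy_other copy_same emb_def)
  then show ?thesis by (simp add: image_image)
qed

text \<open>If \<open>\<tau>\<close> fixes the root of \<open>H\<close>, no base edge moves and only
  the exceptional pair of \<open>\<tau>\<close> is new. If \<open>\<tau>\<close> is an automorphism,
  all fibre edges are preserved and at most the base edge \<open>d0\<close> at \<open>s\<close> is
  disturbed.\<close>

lemma copy_in_gens:
  assumes \<tau>: "\<tau> \<in> gensH" and s: "s \<in> X"
    and low: "\<And>d. d \<in> LG \<Longrightarrow> s \<in> d \<Longrightarrow> d = d0"
    and isolated: "s = i \<Longrightarrow> \<forall>d\<in>LG. s \<notin> d"
  shows "copy s \<tau> \<in> hang_gens P M (Some (j, i))"
proof -
  have perm: "copy s \<tau> permutes P"
    using \<tau> s by (intro copy_permutes) (auto simp: hang_gens_def)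
  consider (near) f where "\<forall>d\<in>star_edges LH. \<tau> ` d \<in> insert f (star_edges LH)"
      "\<tau> (Some j) = Some j"
    | (auto) "\<forall>d\<in>star_edges LH. \<tau> ` d \<in> star_edges LH"
    using \<tau> unfolding hang_gens_def near_aut_def edge_preserving_def by blast
  then show ?thesis
  proof cases
    case near
    have "copy s \<tau> ` d \<in> insert (emb s ` f) M" if "d \<in> M" for d
      using that
    proof (cases rule: M_cases)
      case (base g)
      then show ?thesis using near copy_base[of s g \<tau>] base_in_M by auto
    next
      case (fibre x h)
      then show ?thesis
        using near s copy_fibre[of s h \<tau> "{f}"] copy_other_fibre[of s x \<tau> h] fibre_in_M
        by (cases "x = s") auto
    qed
    moreover have "copy s \<tau> (Some (j, i)) = Some (j, i)"
      using near by (cases "i = s") (auto simp: copy_other copy_same emb_def)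
    ultimately show ?thesis
      using perm unfolding hang_gens_def near_aut_def by blast
  next
    case auto
    have fibres: "copy s \<tau> ` d \<in> M" if "x \<in> X" "h \<in> LH" "d = (\<lambda>b. Some (b, x)) ` h" for d x h
      using that s auto copy_fibre[of s h \<tau> "{}"] copy_other_fibre[of s x \<tau> h] fibre_in_M
      by (cases "x = s") auto
    show ?thesis
    proof (cases "\<forall>d\<in>LG. s \<notin> d")
      case True
      have "copy s \<tau> ` d \<in> M" if "d \<in> M" for d
        using that
      proof (cases rule: M_cases)
        case (base g)
        then show ?thesis using True copy_base[of s g \<tau>] base_in_M by auto
      qed (use fibres in auto)
      then show ?thesis
        using perm unfolding hang_gens_def edge_preserving_def by blast
    next
      case False
      \<comment> \<open>The image of the single base edge at \<open>s\<close> serves as the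
        exceptional pair.\<close>
      have "copy s \<tau> ` d \<in> insert (copy s \<tau> ` (\<lambda>y. Some (j, y)) ` d0) M" if "d \<in> M" for d
        using that
      proof (cases rule: M_cases)
        case (base g)
        then show ?thesis using low copy_base[of s g \<tau>] base_in_M by (cases "s \<in> g") auto
      qed (use fibres in auto)
      \<comment> \<open>Since \<open>s\<close> lies on an edge, \<open>isolated\<close> gives
        \<open>s \<noteq> i\<close>, so the root is in another copy.\<close>
      moreover have "copy s \<tau> (Some (j, i)) = Some (j, i)"
        using False isolated by (intro copy_other) auto
      ultimately show ?thesis
        using perm unfolding hang_gens_def near_aut_def by blast
    qed
  qed
qed

text \<open>Fibres over vertices move as a whole to fibres over vertices, so their edges are
  preserved. Base edges move exactly as the edges of \<open>G\<close> do, which yields the same kind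
  of generator.\<close>

lemma outer_in_gens:
  assumes \<sigma>: "\<sigma> \<in> gensG" and fixes_None: "\<sigma> None = None"
  shows "outer \<sigma> \<in> hang_gens P M (Some (j, i))"
proof -
  have permG: "\<sigma> permutes star_set X" using \<sigma> by (simp add: hang_gens_def)
  have perm: "outer \<sigma> permutes P"
    using permG fixes_None by (rule outer_permutes)
  have base: "outer \<sigma> ` (\<lambda>x. Some (j, x)) ` g = map_option (Pair j) ` \<sigma> ` Some ` g" for g
    by (simp add: image_image outer_def j)
  have lift: "map_option (Pair j) ` d \<in> M" if d: "d \<in> star_edges LG" for d
  proof -
    obtain g where "g \<in> LG" "d = Some ` g" using d by (auto simp: star_edges_def)
    then show ?thesis using base_in_M[of g] by (simp add: image_image)
  qed
  have fibres: "outer \<sigma> ` d \<in> M" if "x \<in> X" "h \<in> LH" "d = (\<lambda>b. Some (b, x)) ` h" for d x h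
  proof -
    have "Some x \<in> star_set X" using that by (simp add: star_set_def)
    then have "\<sigma> (Some x) \<in> star_set X" using permG by (simp add: permutes_in_image)
    moreover have "\<sigma> (Some x) \<noteq> None"
      using permutes_inj[OF permG] fixes_None by (metis injD option.distinct(1))
    ultimately obtain y where y: "y \<in> X" "\<sigma> (Some x) = Some y"
      by (auto simp: star_set_def)
    have "outer \<sigma> ` d = (\<lambda>b. Some (b, y)) ` h"
      using that y LH by (auto simp: image_image outer_def intro!: image_cong)
    then show ?thesis using fibre_in_M y that by auto
  qed
  consider (near) f where "\<forall>d\<in>star_edges LG. \<sigma> ` d \<in> insert f (star_edges LG)"
      "\<sigma> (Some i) = Some i"
    | (auto) "\<forall>d\<in>star_edges LG. \<sigma> ` d \<in> star_edges LG"
    using \<sigma> unfolding hang_gens_def near_aut_def edge_preserving_def by blast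
  then show ?thesis
  proof cases
    case near
    have "outer \<sigma> ` d \<in> insert (map_option (Pair j) ` f) M" if "d \<in> M" for d
      using that
    proof (cases rule: M_cases)
      case (base g)
      have "\<sigma> ` Some ` g \<in> insert f (star_edges LG)"
        using near base by (auto simp: star_edges_def)
      then show ?thesis using lift by (auto simp: base \<open>outer \<sigma> ` (\<lambda>x. Some (j, x)) ` g = _\<close>)
    qed (use fibres in auto)
    moreover have "outer \<sigma> (Some (j, i)) = Some (j, i)"
      using near j by (simp add: outer_def)
    ultimately show ?thesis
      using perm unfolding hang_gens_def near_aut_def by blast
  next
    case auto
    have "outer \<sigma> ` d \<in> M" if "d \<in> M" for d
      using that
    proof (cases rule: M_cases)
      case (base g)
      have "\<sigma> ` Some ` g \<in> star_edges LG"
        using auto base by (auto simp: star_edges_def)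
      then show ?thesis using lift by (auto simp: base \<open>outer \<sigma> ` (\<lambda>x. Some (j, x)) ` g = _\<close>)
    qed (use fibres in auto)
    then show ?thesis
      using perm unfolding hang_gens_def edge_preserving_def by blast
  qed
qed

text \<open>Conjugation by \<open>outer \<sigma>\<close> carries the action on the copy at
  \<open>a\<close> to the copy at \<open>b\<close>. Injectivity keeps every other vertex away from
  both \<open>b\<close> and \<open>None\<close>.\<close>

lemma outer_copy:
  assumes \<sigma>: "inj \<sigma>" "\<sigma> None = None" "\<sigma> (Some a) = Some b" and \<tau>: "\<tau> permutes star_set B"
  shows "outer \<sigma> \<circ> copy a \<tau> = copy b \<tau> \<circ> outer \<sigma>"
proof
  fix q
  have o: "outer \<sigma> (emb a c) = emb b c" if "c \<in> star_set B" for c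
    using that \<sigma> by (auto simp: star_set_def outer_def emb_def)
  have closed: "\<tau> c \<in> star_set B" if "c \<in> star_set B" for c
    using that \<tau> by (simp add: permutes_in_image)
  show "(outer \<sigma> \<circ> copy a \<tau>) q = (copy b \<tau> \<circ> outer \<sigma>) q"
  proof (cases q)
    case None
    then show ?thesis
      using o closed by (simp add: copy_None) (simp add: outer_def copy_None star_set_def)
  next
    case (Some r)
    then obtain c y where q: "q = Some (c, y)" by (cases r) auto
    show ?thesis
    proof (cases "c \<in> B")
      case True
      show ?thesis
      proof (cases "y = a")
        case True
        then show ?thesis
          using q o closed \<open>c \<in> B\<close> \<sigma> by (simp add: copy_same star_set_def)
            (simp add: outer_def copy_same)
      next
        case False
        then obtain z where z: "\<sigma> (Some y) = Some z" "z \<noteq> b"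
          using \<sigma> by (metis injD not_None_eq option.inject)
        then show ?thesis
          using q False True by (simp add: copy_other outer_def)
      qed
    next
      case False
      then have "\<tau> (Some c) = Some c"
        by (intro permutes_not_in[OF \<tau>]) (auto simp: star_set_def)
      then show ?thesis
        using False q by (auto simp: outer_def copy_def emb_def)
    qed
  qed
qed

text \<open>No edge contains \<open>None\<close>, so an edge containing \<open>t\<close> can only be mapped to the exceptional pair
  \<open>f\<close>. The exceptional pair of \<open>\<sigma> \<circ> transpose (Some t) None\<close> is then the image of that edge.\<close>

lemma gensG_to_None:
  assumes \<sigma>: "\<sigma> \<in> gensG" and t: "\<sigma> (Some t) = None"
  shows "\<exists>d0. \<forall>d\<in>LG. t \<in> d \<longrightarrow> d = d0"
    and "t = i \<Longrightarrow> \<forall>d\<in>LG. t \<notin> d"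
    and "\<sigma> \<circ> transpose (Some t) None \<in> gensG"
proof -
  let ?L = "star_edges LG"
  let ?tr = "transpose (Some t) None"
  have perm: "\<sigma> permutes star_set X" using \<sigma> by (simp add: hang_gens_def)
  then have inj: "inj \<sigma>" by (rule permutes_inj)
  have None_L: "None \<notin> d" if "d \<in> ?L" for d
    using that by (auto simp: star_edges_def)
  have tX: "Some t \<in> star_set X"
    using t permutes_not_in[OF perm, of "Some t"] by auto
  then have perm': "\<sigma> \<circ> ?tr permutes star_set X"
    using perm by (intro permutes_compose permutes_swap_id) (auto simp: star_set_def)
  have tr: "?tr ` d = d" if "d \<in> ?L" "Some t \<notin> d" for d
  proof -
    have "?tr x = x" if "x \<in> d" for x
      using that \<open>Some t \<notin> d\<close> None_L[OF \<open>d \<in> ?L\<close>] by (metis transpose_apply_other)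
    then show ?thesis by simp
  qed
  have \<sigma>_tr: "(\<sigma> \<circ> ?tr) ` d = \<sigma> ` d" if "d \<in> ?L" "Some t \<notin> d" for d
    using tr[OF that] by (simp add: image_comp[symmetric] del: o_apply)
  have to_L: "Some ` d \<in> ?L" if "d \<in> LG" for d using that by (simp add: star_edges_def)
  have not_L: "\<sigma> ` d \<notin> ?L" if "Some t \<in> d" for d
    using that t None_L by (metis imageI)
  consider (near) f where "\<forall>d\<in>?L. \<sigma> ` d \<in> insert f ?L" "\<sigma> (Some i) = Some i"
    | (auto) "\<forall>d\<in>?L. \<sigma> ` d \<in> ?L"
    using \<sigma> unfolding hang_gens_def near_aut_def edge_preserving_def by blast
  then have "(\<exists>d0. \<forall>d\<in>LG. t \<in> d \<longrightarrow> d = d0) \<and> (t = i \<longrightarrow> (\<forall>d\<in>LG. t \<notin> d)) \<and> \<sigma> \<circ> ?tr \<in> gensG"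
  proof cases
    case near
    have t_image: "\<sigma> ` d = f" if "d \<in> ?L" "Some t \<in> d" for d
      using that near not_L by blast
    have unique: "d = e" if "d \<in> LG" "t \<in> d" "e \<in> LG" "t \<in> e" for d e
    proof -
      have "\<sigma> ` Some ` d = \<sigma> ` Some ` e" using t_image to_L that by (metis imageI)
      then show ?thesis using inj by (simp add: inj_image_eq_iff)
    qed
    then have 1: "\<exists>d0. \<forall>d\<in>LG. t \<in> d \<longrightarrow> d = d0" by metis
    have "t \<noteq> i" using near t by auto
    have "near_aut ?L (\<sigma> \<circ> ?tr)"
    proof (cases "\<exists>d\<in>?L. Some t \<in> d")
      case True
      then obtain d0 where d0: "d0 \<in> ?L" "Some t \<in> d0" by blast
      \<comment> \<open>Every other edge avoids \<open>t\<close> and is moved as by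
        \<open>\<sigma>\<close>. It cannot land on \<open>f\<close>, which is already the image of
        \<open>d0\<close>, so it lands in \<open>?L\<close>.\<close>
      have "(\<sigma> \<circ> ?tr) ` d \<in> insert (\<sigma> ` ?tr ` d0) ?L" if d: "d \<in> ?L" for d
      proof (cases "d = d0")
        case False
        then have "\<sigma> ` d \<noteq> f"
          using t_image[OF d0] inj by (metis inj_image_eq_iff)
        moreover have "Some t \<notin> d" using \<open>\<sigma> ` d \<noteq> f\<close> t_image d by blast
        ultimately show ?thesis
          using near d \<sigma>_tr[OF d] by auto
      qed (simp add: image_comp)
      then show ?thesis unfolding near_aut_def by blast
    next
      case False
      then have "\<forall>d\<in>?L. (\<sigma> \<circ> ?tr) ` d \<in> insert f ?L"
        using near \<sigma>_tr by auto
      then show ?thesis unfolding near_aut_def by blast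
    qed
    moreover have "(\<sigma> \<circ> ?tr) (Some i) = Some i"
      using \<open>t \<noteq> i\<close> near by (simp add: transpose_def)
    ultimately show ?thesis
      using 1 \<open>t \<noteq> i\<close> perm' by (simp add: hang_gens_def)
  next
    case auto
    \<comment> \<open>An automorphism can send only an isolated vertex to
      \<open>None\<close>.\<close>
    then have iso: "Some t \<notin> d" if "d \<in> ?L" for d using that not_L by blast
    then have "edge_preserving ?L (\<sigma> \<circ> ?tr)"
      using auto \<sigma>_tr unfolding edge_preserving_def by auto
    moreover have "t \<notin> d" if "d \<in> LG" for d
      using iso[OF to_L[OF that]] by auto
    ultimately show ?thesis using perm' by (auto simp: hang_gens_def)
  qed
  then show "\<exists>d0. \<forall>d\<in>LG. t \<in> d \<longrightarrow> d = d0" "t = i \<Longrightarrow> \<forall>d\<in>LG. t \<notin> d"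
    "\<sigma> \<circ> ?tr \<in> gensG" by blast+
qed

section \<open>Spreading goodness over the vertices of G\<close>

definition good :: "'x \<Rightarrow> bool" where
  "good x \<longleftrightarrow> (\<forall>\<tau>. \<tau> permutes star_set B \<longrightarrow> copy x \<tau> \<in> spanP)"

lemma spanP_inv: "p \<in> spanP \<Longrightarrow> inv_fun p \<in> spanP"
  by (rule perm_span_inv_closed[THEN conjunct2]) (auto simp: hang_gens_def permutes_bij)

text \<open>Because \<open>copy x\<close> respects composition and inverses, checking the generators
  for \<open>H\<close> suffices.\<close>

lemma good_if_gens:
  assumes "hang_complete (star_set B) (star_edges LH) (Some j)"
    and "\<And>\<tau>. \<tau> \<in> gensH \<Longrightarrow> copy x \<tau> \<in> spanP"
  shows "good x"
  unfolding good_def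
proof (intro allI impI)
  fix \<tau> assume "\<tau> permutes star_set B"
  then have "\<tau> \<in> perm_span gensH" using assms(1) by (simp add: hang_complete_def)
  then show "copy x \<tau> \<in> spanP"
  proof induction
    case perm_span_id
    then show ?case by (simp add: copy_id perm_span.perm_span_id del: id_apply)
  next
    case (perm_span_incl p)
    then show ?case by (rule assms(2))
  next
    case (perm_span_inv p)
    then have "bij p" by (auto simp: hang_gens_def permutes_bij)
    then show ?case
      using spanP_inv[OF assms(2)[OF perm_span_inv]] by (simp add: copy_inv)
  next
    case (perm_span_comp p q)
    then show ?case by (simp only: copy_comp perm_span.perm_span_comp)
  qed
qed

lemma good_back:
  assumes \<sigma>: "\<sigma> \<in> gensG" "\<sigma> None = None" "\<sigma> (Some a) = Some b" and "good b"
  shows "good a"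
  unfolding good_def
proof (intro allI impI)
  fix \<tau> assume \<tau>: "\<tau> permutes star_set B"
  have b: "bij \<sigma>" using \<sigma> by (auto simp: hang_gens_def permutes_bij)
  have outer: "outer \<sigma> \<in> spanP" using \<sigma> by (intro perm_span_incl outer_in_gens)
  have "bij (outer \<sigma>)"
    using outer_in_gens[OF \<sigma>(1,2)] by (auto simp: hang_gens_def permutes_bij)
  then have "copy a \<tau> = inv_fun (outer \<sigma>) \<circ> (outer \<sigma> \<circ> copy a \<tau>)"
    by (simp add: fun_eq_iff bij_is_inj)
  also have "\<dots> = inv_fun (outer \<sigma>) \<circ> (copy b \<tau> \<circ> outer \<sigma>)"
    using outer_copy[OF bij_is_inj[OF b] \<sigma>(2,3) \<tau>] by simp
  also have "\<dots> \<in> spanP"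
    using outer assms(4) \<tau> by (intro perm_span_comp spanP_inv) (auto simp: good_def)
  finally show "copy a \<tau> \<in> spanP" .
qed

lemma all_good:
  assumes G: "hang_complete (star_set X) (star_edges LG) (Some i)"
    and H: "hang_complete (star_set B) (star_edges LH) (Some j)"
    and x: "x \<in> X"
  shows "good x"
proof -
  let ?A = "star_set {x \<in> X. good x}"
  have step: "a \<in> ?A" if \<sigma>: "\<sigma> \<in> gensG" and a: "\<sigma> a \<in> ?A" for \<sigma> a
  proof (cases a)
    case None
    then show ?thesis by (simp add: star_set_def)
  next
    case (Some y)
    have perm: "\<sigma> permutes star_set X" using \<sigma> by (simp add: hang_gens_def)
    have "\<sigma> a \<in> star_set X" using a by (auto simp: star_set_def)
    then have "a \<in> star_set X" using perm by (simp add: permutes_in_image)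
    then have y: "y \<in> X" using Some by (auto simp: star_set_def)
    have "good y"
    proof (cases "\<sigma> a")
      case None
      then have t: "\<sigma> (Some y) = None" using Some by simp
      \<comment> \<open>By \<open>gensG_to_None\<close>, \<open>y\<close> lies on at most one edge,
        and on none if it is the root: just what \<open>copy_in_gens\<close> asks for.\<close>
      obtain d0 where d0: "\<And>d. d \<in> LG \<Longrightarrow> y \<in> d \<Longrightarrow> d = d0"
        using gensG_to_None(1)[OF \<sigma> t] by blast
      show ?thesis
        using copy_in_gens[OF _ y d0 gensG_to_None(2)[OF \<sigma> t]]
        by (intro good_if_gens[OF H] perm_span_incl) blast
    next
      case (Some b)
      then have b: "good b" using a by (auto simp: star_set_def)
      obtain c where c: "\<sigma> c = None" using permutes_surj[OF perm] by (metis surjD)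
      show ?thesis
      proof (cases c)
        case None
        then show ?thesis
          using good_back[OF \<sigma> _ _ b] c Some \<open>a = Some y\<close> by simp
      next
        case (Some t)
        \<comment> \<open>This fixes \<open>None\<close> and still sends \<open>y\<close> to
          \<open>b\<close>, so goodness can be pulled back along it.\<close>
        let ?\<sigma> = "\<sigma> \<circ> transpose (Some t) None"
        have "t \<noteq> y" using Some c \<open>\<sigma> a = Some b\<close> \<open>a = Some y\<close> by auto
        then have "?\<sigma> None = None" "?\<sigma> (Some y) = Some b"
          using Some c \<open>\<sigma> a = Some b\<close> \<open>a = Some y\<close> by (auto simp: transpose_def)
        then show ?thesis
          using good_back gensG_to_None(3)[OF \<sigma>] Some c b by blast
      qed
    qed
    then show ?thesis using y Some by (simp add: star_set_def)
  qed
  have inv: "\<sigma> a \<in> ?A \<longleftrightarrow> a \<in> ?A" if "\<sigma> \<in> perm_span gensG" for \<sigma> a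
  proof (rule perm_span_invariant[OF _ _ step that])
    show "finite ?A" using finite_X by (simp add: star_set_def)
    show "bij q" if "q \<in> gensG" for q using that by (auto simp: hang_gens_def permutes_bij)
  qed
  \<comment> \<open>Completeness of \<open>G\<close> puts this transposition in the span, so the
    invariant set contains \<open>Some x\<close> along with \<open>None\<close>.\<close>
  have "transpose None (Some x) permutes star_set X"
    using x by (intro permutes_swap_id) (auto simp: star_set_def)
  then have "transpose None (Some x) None \<in> ?A \<longleftrightarrow> None \<in> ?A"
    using G by (intro inv) (simp add: hang_complete_def)
  then show ?thesis by (auto simp: star_set_def)
qed

theorem hang_complete_comb:
  assumes G: "hang_complete (star_set X) (star_edges LG) (Some i)"
    and H: "hang_complete (star_set B) (star_edges LH) (Some j)"
  shows "hang_complete P M (Some (j, i))"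
  unfolding hang_complete_def
proof (intro allI impI)
  fix p assume p: "p permutes P"
  have "transpose None q \<in> spanP" if q: "q \<in> P" for q
  proof (cases q)
    case None
    then show ?thesis by (simp add: perm_span_id)
  next
    case (Some r)
    then obtain b x where r: "q = Some (b, x)" "b \<in> B" "x \<in> X"
      using q by (auto simp: star_set_def)
    \<comment> \<open>A transposition through \<open>None\<close> lives inside a single copy of
      \<open>H\<close>.\<close>
    have "transpose None q r' = copy x (transpose None (Some b)) r'" for r'
    proof (cases r')
      case None
      then show ?thesis by (simp add: r copy_None emb_def)
    next
      case (Some s)
      then obtain c y where "r' = Some (c, y)" by (cases s) auto
      then show ?thesis
        by (cases "y = x"; cases "c = b")
          (simp_all add: r copy_same copy_other emb_def transpose_apply_other)
    qed
    then have "transpose None q = copy x (transpose None (Some b))" by (rule ext)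
    moreover have "transpose None (Some b) permutes star_set B"
      using r by (intro permutes_swap_id) (auto simp: star_set_def)
    ultimately show ?thesis using all_good[OF G H] r by (simp add: good_def)
  qed
  moreover have "finite P" "None \<in> P"
    using finite_X finite_B by (simp_all add: star_set_def)
  ultimately show "p \<in> spanP"
    using p star_transpositions_span[of P None] by blast
qed

end

subsection \<open>Labeled graphs in terms of labels\<close>

lemma vert_label: "labeled_graph K \<Longrightarrow> v \<in> verts K \<Longrightarrow> vert K (label K v) = v"
  by (simp add: vert_def labeled_graph_def)

lemma label_vert: "x \<in> labels K \<Longrightarrow> label K (vert K x) = x"
  by (simp add: vert_def labels_def f_inv_into_f)

lemma vert_in_verts: "x \<in> labels K \<Longrightarrow> vert K x \<in> verts K"
  by (simp add: vert_def labels_def inv_into_into)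

lemma labeled_graph_edgeE:
  assumes "labeled_graph K" and "e \<in> edges K"
  obtains u w where "e = {u, w}" "u \<in> verts K" "w \<in> verts K" "u \<noteq> w"
  using assms by (auto simp: labeled_graph_def vertex_pairs_def card_2_iff)

text \<open>The image form replaces reasoning about pairs of labels by general facts on
  images.\<close>

lemma label_edges_eq:
  assumes K: "labeled_graph K"
  shows "label_edges K = image (label K) ` edges K"
proof
  show "label_edges K \<subseteq> image (label K) ` edges K"
  proof
    fix d assume "d \<in> label_edges K"
    then obtain x y where "d = {x, y}" "x \<in> labels K" "y \<in> labels K" "{vert K x, vert K y} \<in> edges K"
      unfolding label_edges_def by blast
    then show "d \<in> image (label K) ` edges K"
      by (intro image_eqI[of _ _ "{vert K x, vert K y}"]) (simp_all add: label_vert)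
  qed
  show "image (label K) ` edges K \<subseteq> label_edges K"
  proof
    fix d assume "d \<in> image (label K) ` edges K"
    then obtain e where e: "e \<in> edges K" "d = label K ` e" by blast
    obtain u w where uw: "e = {u, w}" "u \<in> verts K" "w \<in> verts K"
      using K e(1) by (rule labeled_graph_edgeE)
    have "d = {label K u, label K w}" "label K u \<in> labels K" "label K w \<in> labels K"
        "{vert K (label K u), vert K (label K w)} \<in> edges K"
      using e uw K by (simp_all add: labels_def vert_label)
    then show "d \<in> label_edges K" unfolding label_edges_def by blast
  qed
qed

lemma labels_star: "labels (add_isolated K) = star_set (labels K)"
  by (auto simp: labels_def add_isolated_def star_set_def image_image)

lemma label_edges_star:
  assumes "rooted_labeled_graph K"
  shows "label_edges (add_isolated K) = star_edges (label_edges K)"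
  using assms rooted_labeled_graph_add_isolated[OF assms]
  by (simp add: label_edges_eq rooted_labeled_graph_def)
    (simp add: add_isolated_def star_edges_def image_image)

lemma labels_comb: "labels (comb_product G H) = labels H \<times> labels G"
proof
  show "labels H \<times> labels G \<subseteq> labels (comb_product G H)"
  proof clarify
    fix b x assume "b \<in> labels H" "x \<in> labels G"
    then obtain u w where "u \<in> verts G" "w \<in> verts H" "b = label H w" "x = label G u"
      by (auto simp: labels_def)
    then show "(b, x) \<in> labels (comb_product G H)"
      by (auto simp: labels_def comb_product_def intro!: image_eqI[of _ _ "(u, w)"])
  qed
qed (auto simp: labels_def comb_product_def)

lemma comb_product_edges:
  assumes G: "labeled_graph G" and H: "labeled_graph H"
  shows "edges (comb_product G H) =
    image (\<lambda>u. (u, root H)) ` edges G \<union> (\<Union>u\<in>verts G. image (Pair u) ` edges H)"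
proof -
  have "{{(u, root H), (u', root H)} | u u'. {u, u'} \<in> edges G}
      = image (\<lambda>u. (u, root H)) ` edges G"
  proof (intro subset_antisym subsetI)
    fix d assume "d \<in> image (\<lambda>u. (u, root H)) ` edges G"
    then obtain e where e: "e \<in> edges G" "d = (\<lambda>u. (u, root H)) ` e" by blast
    obtain u u' where "e = {u, u'}" using G e(1) by (rule labeled_graph_edgeE)
    then show "d \<in> {{(u, root H), (u', root H)} | u u'. {u, u'} \<in> edges G}"
      using e by auto
  next
    fix d assume "d \<in> {{(u, root H), (u', root H)} | u u'. {u, u'} \<in> edges G}"
    then obtain u u' where "{u, u'} \<in> edges G" "d = (\<lambda>u. (u, root H)) ` {u, u'}" by auto
    then show "d \<in> image (\<lambda>u. (u, root H)) ` edges G" by (rule rev_image_eqI)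
  qed
  moreover have "{{(u, w), (u, w')} | u w w'. u \<in> verts G \<and> {w, w'} \<in> edges H}
      = (\<Union>u\<in>verts G. image (Pair u) ` edges H)"
  proof (intro subset_antisym subsetI)
    fix d assume "d \<in> (\<Union>u\<in>verts G. image (Pair u) ` edges H)"
    then obtain u e where e: "u \<in> verts G" "e \<in> edges H" "d = Pair u ` e" by blast
    obtain w w' where "e = {w, w'}" using H e(2) by (rule labeled_graph_edgeE)
    then show "d \<in> {{(u, w), (u, w')} | u w w'. u \<in> verts G \<and> {w, w'} \<in> edges H}"
      using e by auto
  next
    fix d assume "d \<in> {{(u, w), (u, w')} | u w w'. u \<in> verts G \<and> {w, w'} \<in> edges H}"
    then obtain u w w' where "u \<in> verts G" "{w, w'} \<in> edges H" "d = Pair u ` {w, w'}" by auto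
    then show "d \<in> (\<Union>u\<in>verts G. image (Pair u) ` edges H)" by (blast intro: rev_image_eqI)
  qed
  ultimately show ?thesis by (simp add: comb_product_def)
qed

lemma label_edges_comb:
  assumes G: "rooted_labeled_graph G" and H: "rooted_labeled_graph H"
  shows "label_edges (comb_product G H) =
    comb_edges (labels G) (label_edges G) (label_edges H) (label H (root H))"
proof -
  have C: "labeled_graph (comb_product G H)"
    using rooted_labeled_graph_comb_product[OF G H] by (simp add: rooted_labeled_graph_def)
  have GH: "labeled_graph G" "labeled_graph H"
    using G H by (simp_all add: rooted_labeled_graph_def)
  have l: "label (comb_product G H) = (\<lambda>(u, w). (label H w, label G u))"
    by (simp add: comb_product_def)
  show ?thesis
    by (simp add: label_edges_eq C GH comb_product_edges comb_edges_def image_Un image_UN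
        image_image l labels_def)
qed

subsection \<open>The hang group in terms of permutations\<close>

lemma restrict_permutes_Bij: "p permutes X \<Longrightarrow> restrict p X \<in> Bij X"
  by (simp add: Bij_def permutes_imp_bij)

lemma Bij_restrictE:
  assumes "\<sigma> \<in> Bij X"
  obtains p where "p permutes X" "\<sigma> = restrict p X"
proof
  \<comment> \<open>Elements of \<open>Bij X\<close> are \<open>undefined\<close> outside
    \<open>X\<close>, whereas \<open>permutes\<close> demands the identity there.\<close>
  let ?p = "\<lambda>x. if x \<in> X then \<sigma> x else x"
  have "bij_betw \<sigma> X X" using assms by (simp add: Bij_def)
  then have "bij_betw ?p X X" by (simp cong: bij_betw_cong)
  then show "?p permutes X" by (rule bij_imp_permutes) simp
  show "\<sigma> = restrict ?p X"
    using assms by (auto simp: Bij_def extensional_def restrict_def)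
qed

lemma restrict_permutes_inject:
  assumes "p permutes X" and "q permutes X" and "restrict p X = restrict q X"
  shows "p = q"
proof
  fix x
  show "p x = q x"
  proof (cases "x \<in> X")
    case True
    then show ?thesis using fun_cong[OF assms(3), of x] by simp
  qed (use assms(1,2) in \<open>simp add: permutes_not_in\<close>)
qed

lemma BijGroup_mult:
  assumes "p permutes X" and "q permutes X"
  shows "restrict p X \<otimes>\<^bsub>BijGroup X\<^esub> restrict q X = restrict (p \<circ> q) X"
  using assms
  by (auto simp: BijGroup_def restrict_permutes_Bij compose_def permutes_in_image fun_eq_iff)

lemma BijGroup_inv:
  assumes "p permutes X"
  shows "inv\<^bsub>BijGroup X\<^esub> (restrict p X) = restrict (inv_fun p) X"
proof (rule group.inv_equality[OF group_BijGroup])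
  show "restrict (inv_fun p) X \<otimes>\<^bsub>BijGroup X\<^esub> restrict p X = \<one>\<^bsub>BijGroup X\<^esub>"
    using assms by (subst BijGroup_mult)
      (auto simp: permutes_inv permutes_inv_o BijGroup_def fun_eq_iff permutes_inverses)
qed (use assms in \<open>auto simp: BijGroup_def restrict_permutes_Bij permutes_inv\<close>)

lemma edge_preserving_iff:
  assumes "finite L" and "inj p"
  shows "edge_preserving L p \<longleftrightarrow> image p ` L = L"
proof
  assume "edge_preserving L p"
  then have "image p ` L \<subseteq> L" by (auto simp: edge_preserving_def)
  moreover have "inj_on (image p) L"
    using assms(2) by (simp add: inj_on_def inj_image_eq_iff)
  ultimately show "image p ` L = L" using assms(1) by (intro endo_inj_surj)
qed (auto simp: edge_preserving_def)

lemma near_aut_if_subset: "image p ` L \<subseteq> insert f L \<Longrightarrow> near_aut L p"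
  unfolding near_aut_def image_subset_iff by (rule exI)

text \<open>Equal size and \<open>A \<noteq> C\<close> force \<open>f\<close> into \<open>A\<close>
  but not into \<open>C\<close>. Then \<open>A - {f}\<close> is a subset of \<open>C\<close> with
  exactly one element missing.\<close>

lemma exchange_one_element:
  assumes "finite C" and "card A = card C" and "A \<subseteq> insert f C" and "A \<noteq> C"
  shows "\<exists>e. e \<in> C \<and> f \<notin> C \<and> A = C - {e} \<union> {f}"
proof -
  have "\<not> A \<subseteq> C" using card_subset_eq[OF assms(1) _ assms(2)] assms(4) by blast
  then have f: "f \<in> A" "f \<notin> C" using assms(3) by blast+
  have "finite A" using assms(1,3) by (rule finite_subset[rotated, OF finite.insertI])
  then have "card A > 0" using f(1) by (auto simp: card_gt_0_iff)
  moreover have sub: "A - {f} \<subseteq> C" using assms(3) by blast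
  ultimately have "card (C - (A - {f})) = 1"
    using \<open>finite A\<close> f(1) assms(2) by (subst card_Diff_subset) simp_all
  then obtain e where e: "C - (A - {f}) = {e}" by (rule card_1_singletonE)
  then have "A - {f} = C - {e}" using double_diff[OF sub subset_refl] by simp
  then have "A = C - {e} \<union> {f}" using f(1) by blast
  moreover have "e \<in> C" using e by blast
  ultimately show ?thesis using f(2) by blast
qed

text \<open>An injective \<open>p\<close> preserves the number of edges, so counting leaves only the
  two cases of a neutral replacement and a proper one.\<close>

lemma near_aut_cases:
  assumes L: "finite L" and p: "inj p" and near: "near_aut L p"
  shows "image p ` L = L \<or> (\<exists>e f. e \<in> L \<and> f \<notin> L \<and> image p ` L = L - {e} \<union> {f})"
proof -
  obtain f where "\<forall>d\<in>L. p ` d \<in> insert f L"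
    using near unfolding near_aut_def ..
  then have f: "image p ` L \<subseteq> insert f L" by (simp add: image_subset_iff)
  have "inj_on (image p) L"
    using p by (simp add: inj_on_def inj_image_eq_iff)
  then have card: "card (image p ` L) = card L" by (rule card_image)
  show ?thesis
  proof (cases "image p ` L = L")
    case False
    then obtain e where "e \<in> L \<and> f \<notin> L \<and> image p ` L = L - {e} \<union> {f}"
      using exchange_one_element[OF L card f] by metis
    then show ?thesis by metis
  qed simp
qed

section \<open>Edge replacements read off on the label set\<close>

context
  fixes K :: "('v, 'x, 'm) lgraph_scheme"
  assumes K: "labeled_graph K"
begin

abbreviation (input) "X \<equiv> labels K"
abbreviation (input) "L \<equiv> label_edges K"

lemma finite_labels: "finite X" and finite_label_edges: "finite L"
    and label_edges_pairs: "d \<in> L \<Longrightarrow> d \<subseteq> X \<and> card d = 2"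
proof -
  have V: "finite (verts K)" "edges K \<subseteq> Pow (verts K)" "inj_on (label K) (verts K)"
    using K by (auto simp: labeled_graph_def vertex_pairs_def)
  show "finite X" using V by (simp add: labels_def)
  show "finite L" using V unfolding label_edges_eq[OF K]
    by (meson finite_Pow_iff finite_imageI finite_subset)
  show "d \<subseteq> X \<and> card d = 2" if d: "d \<in> L"
  proof -
    obtain e where e: "e \<in> edges K" "d = label K ` e"
      using d by (auto simp: label_edges_eq[OF K])
    then have "e \<subseteq> verts K" "card e = 2"
      using K by (auto simp: labeled_graph_def vertex_pairs_def)
    then show ?thesis using e V(3) by (auto simp: labels_def card_image inj_on_subset)
  qed
qed

lemma inj_on_vert: "inj_on (vert K) X"
  by (metis inj_onI label_vert)

lemma edges_eq: "edges K = image (vert K) ` L"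
proof -
  have "vert K ` label K ` e = e" if "e \<in> edges K" for e
    using that by (rule labeled_graph_edgeE[OF K]) (simp add: vert_label K)
  then show ?thesis by (simp add: label_edges_eq[OF K] image_image)
qed

text \<open>Taking images under \<open>vert K\<close> is injective on families of label sets, so
  equations between edge sets become equations between label edges.\<close>

lemma vert_images_eq_iff:
  assumes "A \<subseteq> Pow X" and "C \<subseteq> Pow X"
  shows "image (vert K) ` A = image (vert K) ` C \<longleftrightarrow> A = C"
  using inj_on_image_eq_iff[OF inj_on_image_Pow[OF inj_on_vert] assms] .

lemma edges_permuted:
  assumes p: "p permutes X"
  shows "edges (permuted K (restrict p X)) = image (vert K) ` image (inv_fun p) ` L"
proof (intro subset_antisym subsetI)
  fix d assume "d \<in> edges (permuted K (restrict p X))"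
  then obtain x y where xy: "x \<in> X" "y \<in> X" "p ` {x, y} \<in> L" "d = vert K ` {x, y}"
    unfolding permuted_def by auto
  have "inv_fun p ` p ` {x, y} = {x, y}"
    using p by (simp add: permutes_inverses)
  then show "d \<in> image (vert K) ` image (inv_fun p) ` L" using xy by (metis imageI)
next
  fix d assume "d \<in> image (vert K) ` image (inv_fun p) ` L"
  then obtain c where c: "c \<in> L" "d = vert K ` inv_fun p ` c" by blast
  obtain x y where xy: "c = {x, y}" "x \<in> X" "y \<in> X"
    using label_edges_pairs[OF c(1)] by (auto simp: card_2_iff)
  have "d = {vert K (inv_fun p x), vert K (inv_fun p y)}" "inv_fun p x \<in> X" "inv_fun p y \<in> X"
    using c xy permutes_in_image[OF permutes_inv[OF p]] by auto
  moreover have "{restrict p X (inv_fun p x), restrict p X (inv_fun p y)} \<in> L"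
    using calculation c xy p by (simp add: permutes_inverses)
  ultimately show "d \<in> edges (permuted K (restrict p X))"
    unfolding permuted_def by auto
qed

lemma inv_edges_subset:
  assumes "p permutes X"
  shows "image (inv_fun p) ` L \<subseteq> Pow X"
proof clarify
  fix d x assume "d \<in> L" "x \<in> d"
  then have "x \<in> X" using label_edges_pairs by blast
  then show "inv_fun p x \<in> X" using permutes_in_image[OF permutes_inv[OF assms]] by blast
qed

lemma label_edges_subset: "L \<subseteq> Pow X"
  using label_edges_pairs by blast

lemma update_edges_eq_iff: "K\<lparr>edges := A\<rparr> = K\<lparr>edges := C\<rparr> \<longleftrightarrow> A = C"
  by (metis lgraph.select_convs(2) lgraph.surjective lgraph.update_convs(2))

text \<open>Only the edge field changes, so equality of whole records reduces to equality of edge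
  sets.\<close>

lemma permuted_eq_iff: "permuted K \<sigma> = K\<lparr>edges := A\<rparr> \<longleftrightarrow> edges (permuted K \<sigma>) = A"
  unfolding permuted_def update_edges_eq_iff by simp

lemma Aut_iff:
  assumes p: "p permutes X"
  shows "restrict p X \<in> Aut K \<longleftrightarrow> image (inv_fun p) ` L = L"
proof -
  have "permuted K (restrict p X) = K \<longleftrightarrow> edges (permuted K (restrict p X)) = edges K"
    using permuted_eq_iff[of _ "edges K"] by simp
  also have "\<dots> \<longleftrightarrow> image (inv_fun p) ` L = L"
    unfolding edges_permuted[OF p] unfolding edges_eq
    by (rule vert_images_eq_iff[OF inv_edges_subset[OF p] label_edges_subset])
  finally show ?thesis
    using p by (simp add: Aut_def BijGroup_def restrict_permutes_Bij)
qed

lemma edges_replace_edge: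
  assumes "e \<subseteq> X" "f \<subseteq> X"
  shows "edges (replace_edge K e f) = image (vert K) ` (L - {e} \<union> {f})"
proof -
  have "image (vert K) ` (L - {e}) = image (vert K) ` L - image (vert K) ` {e}"
    using inj_on_image_Pow[OF inj_on_vert] label_edges_subset assms
    by (intro inj_on_image_set_diff) auto
  then show ?thesis by (simp add: replace_edge_def edges_eq)
qed

lemma Fer_Replace_iff:
  assumes p: "p permutes X" and ef: "e \<subseteq> X" "f \<subseteq> X"
  shows "restrict p X \<in> Fer K (Replace e f) \<longleftrightarrow> image (inv_fun p) ` L = L - {e} \<union> {f}"
proof -
  have "permuted K (restrict p X) = replace_edge K e f
      \<longleftrightarrow> edges (permuted K (restrict p X)) = edges (replace_edge K e f)"
    unfolding replace_edge_def permuted_eq_iff by simp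
  also have "\<dots> \<longleftrightarrow> image (inv_fun p) ` L = L - {e} \<union> {f}"
    unfolding edges_permuted[OF p] edges_replace_edge[OF ef]
    using label_edges_subset ef by (intro vert_images_eq_iff[OF inv_edges_subset[OF p]]) auto
  finally show ?thesis
    using p by (simp add: BijGroup_def restrict_permutes_Bij)
qed

lemma vert_edge_iff: "d \<subseteq> X \<Longrightarrow> vert K ` d \<in> edges K \<longleftrightarrow> d \<in> L"
  unfolding edges_eq
  using inj_on_image_mem_iff[OF inj_on_image_Pow[OF inj_on_vert] _ label_edges_subset] by simp

text \<open>The isomorphism is \<open>p\<close> transported to vertices. Hence any permutation
  realizing a replacement also certifies its feasibility.\<close>

lemma graph_isomorphic_permuted:
  assumes p: "p permutes X"
  shows "graph_isomorphic (permuted K (restrict p X)) K"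
  unfolding graph_isomorphic_def
proof (intro exI conjI ballI)
  let ?f = "vert K \<circ> p \<circ> label K"
  have "bij_betw (label K) (verts K) X"
    using K by (simp add: bij_betw_def labels_def labeled_graph_def)
  moreover have "bij_betw (vert K) X (verts K)"
    unfolding vert_def labels_def using K
    by (intro bij_betw_inv_into) (simp add: bij_betw_def labeled_graph_def)
  ultimately have "bij_betw ?f (verts K) (verts K)"
    using permutes_imp_bij[OF p] by (blast intro: bij_betw_trans)
  then show "bij_betw ?f (verts (permuted K (restrict p X))) (verts K)"
    by (simp add: permuted_def)
  fix u w
  assume "u \<in> verts (permuted K (restrict p X))" "w \<in> verts (permuted K (restrict p X))"
  then have uw: "u \<in> verts K" "w \<in> verts K" by (simp_all add: permuted_def)
  then have l: "label K u \<in> X" "label K w \<in> X" by (simp_all add: labels_def)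
  then have pl: "p (label K u) \<in> X" "p (label K w) \<in> X" using p by (simp_all add: permutes_in_image)
  have "{u, w} = vert K ` {label K u, label K w}" using uw by (simp add: vert_label K)
  then have "{u, w} \<in> edges (permuted K (restrict p X))
      \<longleftrightarrow> {label K u, label K w} \<in> image (inv_fun p) ` L"
    unfolding edges_permuted[OF p]
    using inj_on_image_mem_iff[OF inj_on_image_Pow[OF inj_on_vert] _ inv_edges_subset[OF p],
        of "{label K u, label K w}"] l
    by simp
  also have "\<dots> \<longleftrightarrow> p ` {label K u, label K w} \<in> L"
  proof
    assume "{label K u, label K w} \<in> image (inv_fun p) ` L"
    then obtain d where "d \<in> L" "{label K u, label K w} = inv_fun p ` d" by blast
    then show "p ` {label K u, label K w} \<in> L"
      using p by (simp add: image_image permutes_inverses del: image_insert)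
  next
    assume "p ` {label K u, label K w} \<in> L"
    then show "{label K u, label K w} \<in> image (inv_fun p) ` L"
      using p by (intro image_eqI[of _ _ "p ` {label K u, label K w}"])
        (simp_all add: image_image permutes_inverses)
  qed
  also have "\<dots> \<longleftrightarrow> {?f u, ?f w} \<in> edges K"
    using vert_edge_iff[of "p ` {label K u, label K w}"] pl by simp
  finally show "{u, w} \<in> edges (permuted K (restrict p X)) \<longleftrightarrow> {?f u, ?f w} \<in> edges K" .
qed

text \<open>\<open>G\<^sub>\<sigma>\<close> has the preimage of the edge set under \<open>\<sigma>\<close> as its edge set, whereas \<^const>\<open>near_aut\<close>
  is stated with images; hence the inverse.\<close>

lemma Fer_perms_iff:
  assumes p: "p permutes X"
  shows "restrict p X \<in> Fer_perms K \<longleftrightarrow> near_aut L (inv_fun p)"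
proof
  assume "restrict p X \<in> Fer_perms K"
  then obtain \<rho> where \<rho>: "\<rho> \<in> feasible_replacements K" "restrict p X \<in> Fer K \<rho>"
    unfolding Fer_perms_def by blast
  show "near_aut L (inv_fun p)"
  proof (cases \<rho>)
    case Neutral
    then have "image (inv_fun p) ` L = L" using \<rho>(2) Aut_iff[OF p] by simp
    then have "image (inv_fun p) ` L \<subseteq> insert f L" for f by (simp only: subset_insertI)
    then show ?thesis by (rule near_aut_if_subset)
  next
    case (Replace e f)
    then have ef: "e \<subseteq> X" "f \<subseteq> X"
      using \<rho>(1) by (simp_all add: feasible_replacements_def feasible_def edge_replacement_def)
    have "L - {e} \<union> {f} \<subseteq> insert f L" by blast
    then have "image (inv_fun p) ` L \<subseteq> insert f L"
      unfolding Fer_Replace_iff[OF p ef, THEN iffD1, OF \<rho>(2)[unfolded Replace]] .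
    then show ?thesis by (rule near_aut_if_subset)
  qed
next
  assume "near_aut L (inv_fun p)"
  then have "image (inv_fun p) ` L = L
      \<or> (\<exists>e f. e \<in> L \<and> f \<notin> L \<and> image (inv_fun p) ` L = L - {e} \<union> {f})"
    by (rule near_aut_cases[OF finite_label_edges permutes_inj[OF permutes_inv[OF p]]])
  then show "restrict p X \<in> Fer_perms K"
  proof (elim disjE exE conjE)
    assume "image (inv_fun p) ` L = L"
    then have "restrict p X \<in> Fer K Neutral" using Aut_iff[OF p] by simp
    then show ?thesis unfolding Fer_perms_def feasible_replacements_def by blast
  next
    fix e f assume ef: "e \<in> L" "f \<notin> L" and eq: "image (inv_fun p) ` L = L - {e} \<union> {f}"
    have eX: "e \<subseteq> X" using ef label_edges_pairs by blast
    \<comment> \<open>As the image of an edge, \<open>f\<close> is a two-element set of labels; not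
      being in \<open>L\<close>, it names an edge of the complement.\<close>
    have f_mem: "f \<in> image (inv_fun p) ` L" unfolding eq by simp
    then obtain d where d: "d \<in> L" "f = inv_fun p ` d" by (rule imageE)
    have fX: "f \<subseteq> X" using subsetD[OF inv_edges_subset[OF p] f_mem] by (rule PowD)
    have "card f = 2"
      using d label_edges_pairs permutes_inj_on[OF permutes_inv[OF p]] by (simp add: card_image)
    then have "card (vert K ` f) = 2"
      using card_image[OF inj_on_subset[OF inj_on_vert fX]] by metis
    moreover have "vert K ` f \<subseteq> verts K"
      using vert_in_verts[OF subsetD[OF fX]] by (rule image_subsetI)
    ultimately have "vert K ` f \<in> compl_edges K"
      using vert_edge_iff[OF fX] ef by (simp add: compl_edges_def vertex_pairs_def)
    moreover have Fer: "restrict p X \<in> Fer K (Replace e f)"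
      using Fer_Replace_iff[OF p eX fX] eq by blast
    then have "permuted K (restrict p X) = replace_edge K e f" by simp
    then have "graph_isomorphic (replace_edge K e f) K"
      using graph_isomorphic_permuted[OF p] by simp
    ultimately have "feasible K e f"
      using eX fX ef vert_edge_iff[OF eX] by (simp add: feasible_def edge_replacement_def)
    then have "Replace e f \<in> feasible_replacements K"
      using ef by (auto simp: feasible_replacements_def)
    then show ?thesis using Fer unfolding Fer_perms_def by blast
  qed
qed

lemma hang_gens_iff:
  assumes p: "p permutes X" and r: "r \<in> X"
  shows "restrict p X \<in> Fer_perms_fixing K r \<union> Aut K \<longleftrightarrow> inv_fun p \<in> hang_gens X L r"
proof -
  have "restrict p X r = r \<longleftrightarrow> inv_fun p r = r"
    using p r by (auto simp: permutes_inv_eq)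
  moreover have "restrict p X \<in> Aut K \<longleftrightarrow> edge_preserving L (inv_fun p)"
    using Aut_iff[OF p] edge_preserving_iff[OF finite_label_edges permutes_inj[OF permutes_inv[OF p]]]
    by blast
  ultimately show ?thesis
    using Fer_perms_iff[OF p] permutes_inv[OF p]
    by (auto simp: Fer_perms_fixing_def hang_gens_def)
qed

text \<open>By \<open>hang_gens_iff\<close>, the generators on either side are the inverses of those
  on the other, and both closures contain inverses.\<close>

lemma hang_group_eq:
  assumes r: "r \<in> X"
  shows "hang_group K r = (\<lambda>p. restrict p X) ` perm_span (hang_gens X L r)"
proof (intro subset_antisym subsetI)
  let ?S = "hang_gens X L r"
  fix \<sigma> assume "\<sigma> \<in> hang_group K r"
  then have "\<exists>p. p permutes X \<and> p \<in> perm_span ?S \<and> \<sigma> = restrict p X"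
    unfolding hang_group_def
  proof (induction rule: generate.induct)
    case one
    have "\<one>\<^bsub>BijGroup X\<^esub> = restrict id X" by (auto simp: BijGroup_def)
    then show ?case using permutes_id perm_span_id by blast
  next
    case (incl h)
    then have "h \<in> Bij X"
      by (auto simp: Aut_def Fer_perms_fixing_def BijGroup_def Fer_perms_def
          feasible_replacements_def)
    then obtain p where p: "p permutes X" "h = restrict p X" by (rule Bij_restrictE)
    then have "inv_fun p \<in> ?S" using incl hang_gens_iff[OF p(1) r] by simp
    then have "inv_fun (inv_fun p) \<in> perm_span ?S" by (rule perm_span_inv)
    then show ?case using p by (auto simp: permutes_inv_inv)
  next
    case (inv h)
    then have "h \<in> Bij X"
      by (auto simp: Aut_def Fer_perms_fixing_def BijGroup_def Fer_perms_def
          feasible_replacements_def)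
    then obtain p where p: "p permutes X" "h = restrict p X" by (rule Bij_restrictE)
    then have "inv_fun p \<in> ?S" using inv hang_gens_iff[OF p(1) r] by simp
    then show ?case
      unfolding p(2) BijGroup_inv[OF p(1)] using permutes_inv[OF p(1)] perm_span_incl by blast
  next
    case (eng h1 h2)
    then obtain p q where "p permutes X" "p \<in> perm_span ?S" "h1 = restrict p X"
      "q permutes X" "q \<in> perm_span ?S" "h2 = restrict q X" by blast
    then show ?case
      using BijGroup_mult permutes_compose perm_span_comp by metis
  qed
  then show "\<sigma> \<in> (\<lambda>p. restrict p X) ` perm_span ?S" by blast
next
  let ?S = "hang_gens X L r"
  fix \<sigma> assume "\<sigma> \<in> (\<lambda>p. restrict p X) ` perm_span ?S"
  then obtain p where p: "p \<in> perm_span ?S" "\<sigma> = restrict p X" by blast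
  have gen: "q permutes X \<and> restrict (inv_fun q) X \<in> Fer_perms_fixing K r \<union> Aut K"
    if "q \<in> ?S" for q
  proof -
    have q: "q permutes X" using that by (simp add: hang_gens_def)
    then show ?thesis
      using hang_gens_iff[OF permutes_inv[OF q] r] that by (simp add: permutes_inv_inv)
  qed
  from p(1) have "p permutes X \<and> restrict p X \<in> hang_group K r"
    unfolding hang_group_def
  proof induction
    case perm_span_id
    have "restrict id X = \<one>\<^bsub>BijGroup X\<^esub>" by (auto simp: BijGroup_def)
    then show ?case by (simp add: permutes_id generate.one del: id_apply)
  next
    case (perm_span_incl q)
    have "inv\<^bsub>BijGroup X\<^esub> (restrict (inv_fun q) X)
        \<in> generate (BijGroup X) (Fer_perms_fixing K r \<union> Aut K)"
      using gen[OF perm_span_incl] by (intro generate.inv) blast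
    moreover have "q permutes X" using gen[OF perm_span_incl] by blast
    ultimately show ?case
      unfolding BijGroup_inv[OF permutes_inv[OF \<open>q permutes X\<close>]]
        permutes_inv_inv[OF \<open>q permutes X\<close>] by blast
  next
    case (perm_span_inv q)
    then show ?case
      using gen by (blast intro: generate.incl permutes_inv)
  next
    case (perm_span_comp p q)
    then show ?case
      using BijGroup_mult[of p X q] generate.eng permutes_compose by metis
  qed
  then show "\<sigma> \<in> hang_group K r" using p by simp
qed

end

text \<open>Restriction to the label set is a bijection from permutations to \<open>Bij\<close>, so
  exhausting the one group means exhausting the other.\<close>

lemma hang_symmetric_root_iff:
  assumes "rooted_labeled_graph K"
  shows "hang_symmetric_root K r \<longleftrightarrow>
    label K (root K) = r \<and> hang_complete (labels K) (label_edges K) r"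
proof (cases "label K (root K) = r")
  case True
  have K: "labeled_graph K" and r: "r \<in> labels K"
    using assms True by (auto simp: rooted_labeled_graph_def labels_def)
  let ?S = "perm_span (hang_gens (labels K) (label_edges K) r)"
  have perm: "p permutes labels K" if "p \<in> ?S" for p
    using that
    by induction
      (simp_all add: hang_gens_def permutes_id permutes_inv permutes_compose del: o_apply id_apply)
  have "hang_group K r = Bij (labels K) \<longleftrightarrow> (\<forall>p. p permutes labels K \<longrightarrow> p \<in> ?S)"
  proof (intro iffI allI impI)
    fix p assume "hang_group K r = Bij (labels K)" and p: "p permutes labels K"
    then have "restrict p (labels K) \<in> (\<lambda>p. restrict p (labels K)) ` ?S"
      using hang_group_eq[OF K r] restrict_permutes_Bij by blast
    then show "p \<in> ?S" using p perm restrict_permutes_inject by blast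
  next
    assume "\<forall>p. p permutes labels K \<longrightarrow> p \<in> ?S"
    then have "?S = {p. p permutes labels K}" using perm by blast
    then show "hang_group K r = Bij (labels K)"
      unfolding hang_group_eq[OF K r]
      by (auto intro: restrict_permutes_Bij elim!: Bij_restrictE)
  qed
  then show ?thesis
    using True by (simp add: hang_symmetric_root_def hang_complete_def BijGroup_def)
qed (simp add: hang_symmetric_root_def)

theorem corollary8:
  fixes G :: "('v, 'x) rlgraph" and H :: "('w, 'b) rlgraph" and i :: 'x and j :: 'b
  assumes "rooted_labeled_graph G" and "label G (root G) = i"
    and "rooted_labeled_graph H" and "label H (root H) = j"
    and "hang_symmetric_root (add_isolated G) (Some i)"
    and "hang_symmetric_root (add_isolated H) (Some j)"
  shows "hang_symmetric_root (add_isolated (comb_product G H)) (Some (j, i))"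
proof -
  note C = rooted_labeled_graph_comb_product[OF assms(1,3)]
  have "labeled_graph G" "labeled_graph H" "i \<in> labels G" "j \<in> labels H"
    using assms by (auto simp: rooted_labeled_graph_def labels_def)
  then interpret comb_labels "labels G" "label_edges G" i "labels H" "label_edges H" j
    by unfold_locales (simp_all add: finite_labels label_edges_subset)
  have "hang_complete (star_set (labels G)) (star_edges (label_edges G)) (Some i)"
    "hang_complete (star_set (labels H)) (star_edges (label_edges H)) (Some j)"
    using assms
    by (simp_all add: hang_symmetric_root_iff rooted_labeled_graph_add_isolated labels_star
        label_edges_star)
  then have "hang_complete (star_set (labels H \<times> labels G))
      (star_edges (comb_edges (labels G) (label_edges G) (label_edges H) j)) (Some (j, i))"
    by (rule hang_complete_comb)
  moreover have "label (add_isolated (comb_product G H)) (root (add_isolated (comb_product G H)))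
      = Some (j, i)"
    using assms by (simp add: add_isolated_def comb_product_def)
  ultimately show ?thesis
    using assms C
    by (simp add: hang_symmetric_root_iff rooted_labeled_graph_add_isolated labels_star
        label_edges_star labels_comb label_edges_comb)
qed

end
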